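(* Let $s\ge 1$ be an integer and let $G$ be a group. Then $G$ is permutation stable of degree $\le s$ ($P_s$-stable) if and only if the universal polynomial group $\mathrm{Pol}_s(G)$ is permutation stable ($P$-stable).
   Context: Difference operators and polynomial maps: for groups $G,H$, a map $f:G\to H$ and $g\in G$, define $\partial_g f:G\to H$ by $(\partial_g f)(x)=f(gx)f(x)^{-1}$, and put $\partial_{g_1,\ldots,g_k}f=\partial_{g_1}(\partial_{g_2}(\cdots\partial_{g_k}f))$. The map $f$ is polynomial of degree $\le s$ if $(\partial_{g_1,\ldots,g_{s+1}}f)(x)=1$ for all $x,g_1,\ldots,g_{s+1}\in G$; equivalently, if $(\partial_{g_1,\ldots,g_{s+1}}f)(1)=1$ for all $g_1,\ldots,g_{s+1}\in G$. It is unital if $f(1)=1$. Universal polynomial group: let $F_G$ be the free group on the symbols $\{x_g : g\in G\setminus\{1\}\}$, set $x_1=1$, and let $\iota:G\to F_G$, $\iota(g)=x_g$. Let $R_s(G)$ be the normal closure in $F_G$ of all elements $(\partial_{g_1,\ldots,g_{s+1}}\iota)(1)$, $g_1,\ldots,g_{s+1}\in G$. Then $\mathrm{Pol}_s(G)=F_G/R_s(G)$. Metric: $\mathrm{Sym}(n)$ carries the normalized Hamming distance $d_n(\sigma,\tau)=1-\frac1n|\mathrm{Fix}(\sigma^{-1}\tau)|$. $P$-stability: an almost-homomorphism of a group $\Gamma$ is a sequence of maps $f_n:\Gamma\to\mathrm{Sym}(m_n)$ ($m_n$ positive integers) with $\lim_n d_{m_n}(f_n(g)f_n(h),f_n(gh))=0$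 for all $g,h\in\Gamma$. $\Gamma$ is $P$-stable if for every almost-homomorphism $(f_n)_n$ there are homomorphisms $\rho_n:\Gamma\to\mathrm{Sym}(m_n)$ with $\lim_n d_{m_n}(\rho_n(g),f_n(g))=0$ for all $g\in\Gamma$. $P_s$-stability: a sequence of maps $f_n:G\to\mathrm{Sym}(m_n)$ is asymptotically unital if $\lim_n d_{m_n}(f_n(1),1)=0$. An asymptotically unital sequence is almost-polynomial of degree $\le s$ if $\lim_n d_{m_n}((\partial_{g_1,\ldots,g_{s+1}}f_n)(1),1)=0$ for all $g_1,\ldots,g_{s+1}\in G$. $G$ is $P_s$-stable if for every almost-polynomial sequence $(f_n)_n$ of degree $\le s$ of $G$ there are unital polynomial maps $\rho_n:G\to\mathrm{Sym}(m_n)$ of degree $\le s$ with $\lim_n d_{m_n}(\rho_n(g),f_n(g))=0$ for all $g\in G$. *)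

theory Defs
  imports Complex_Main "HOL-Algebra.Sym_Groups"
begin

section \<open>Free groups\<close>

text \<open>The letter \<open>(x, True)\<close> stands for the generator \<open>x\<close>, and \<open>(x, False)\<close> for its
  inverse. The elements of the free group are the reduced words.\<close>

definition inv_letter :: "'a \<times> bool \<Rightarrow> 'a \<times> bool" where
  "inv_letter l = (fst l, \<not> snd l)"

definition reduced :: "('a \<times> bool) list \<Rightarrow> bool" where
  "reduced w \<longleftrightarrow> successively (\<lambda>k l. l \<noteq> inv_letter k) w"

fun cons_reduce :: "'a \<times> bool \<Rightarrow> ('a \<times> bool) list \<Rightarrow> ('a \<times> bool) list" where
  "cons_reduce k [] = [k]"
| "cons_reduce k (l # w) = (if l = inv_letter k then w else k # l # w)"

text \<open>The product of two reduced words is the reduced form of their concatenation.\<close>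

definition free_group :: "'a set \<Rightarrow> ('a \<times> bool) list monoid" where
  "free_group S = \<lparr> carrier = {w \<in> lists (S \<times> UNIV). reduced w},
     mult = foldr cons_reduce, one = [] \<rparr>"

lemma inv_letter_inv_letter [simp]: "inv_letter (inv_letter k) = k"
  by (simp add: inv_letter_def)

lemma inv_letter_in_iff [simp]: "inv_letter k \<in> S \<times> UNIV \<longleftrightarrow> k \<in> S \<times> UNIV"
  by (cases k) (simp add: inv_letter_def)

lemma reduced_Nil [simp]: "reduced []"
  by (simp add: reduced_def)

lemma reduced_Cons: "reduced (k # w) \<longleftrightarrow> reduced w \<and> (w = [] \<or> hd w \<noteq> inv_letter k)"
  by (cases w) (auto simp: reduced_def)

lemma reduced_cons_reduce: "reduced w \<Longrightarrow> reduced (cons_reduce k w)"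
  by (cases w) (auto simp: reduced_Cons)

lemma cons_reduce_reduced: "reduced (k # w) \<Longrightarrow> cons_reduce k w = k # w"
  by (cases w) (auto simp: reduced_Cons)

lemma cons_reduce_inv_letter:
  assumes "reduced w"
  shows "cons_reduce k (cons_reduce (inv_letter k) w) = w"
proof (cases w)
  case (Cons l v)
  then show ?thesis
    using assms by (cases "l = k") (auto simp: cons_reduce_reduced)
qed simp

lemma reduced_foldr: "reduced v \<Longrightarrow> reduced (foldr cons_reduce u v)"
  by (induction u) (auto intro: reduced_cons_reduce)

lemma lists_foldr:
  assumes "u \<in> lists A" "v \<in> lists A"
  shows "foldr cons_reduce u v \<in> lists A"
proof -
  have "cons_reduce k w \<in> lists A" if "k \<in> A" "w \<in> lists A" for k w
    using that by (cases w) auto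
  then show ?thesis
    using assms by (induction u) auto
qed

lemma foldr_reduced_Nil: "reduced w \<Longrightarrow> foldr cons_reduce w [] = w"
  by (induction w) (auto simp: cons_reduce_reduced, auto simp: reduced_Cons cons_reduce_reduced)

lemma foldr_cons_reduce:
  assumes "reduced w"
  shows "foldr cons_reduce (cons_reduce k v) w = cons_reduce k (foldr cons_reduce v w)"
proof (cases v)
  case (Cons l v')
  have "cons_reduce k (cons_reduce (inv_letter k) (foldr cons_reduce v' w)) = foldr cons_reduce v' w"
    using assms by (intro cons_reduce_inv_letter reduced_foldr)
  then show ?thesis
    using Cons by auto
qed simp

lemma foldr_assoc:
  assumes "reduced w"
  shows "foldr cons_reduce (foldr cons_reduce u v) w = foldr cons_reduce u (foldr cons_reduce v w)"
  by (induction u) (simp_all add: foldr_cons_reduce assms)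

lemma foldr_inverse:
  assumes "reduced v"
  shows "foldr cons_reduce (map inv_letter (rev w)) (foldr cons_reduce w v) = v"
  using assms
proof (induction w)
  case (Cons k w)
  have "cons_reduce (inv_letter k) (cons_reduce k (foldr cons_reduce w v)) = foldr cons_reduce w v"
    using cons_reduce_inv_letter[of "foldr cons_reduce w v" "inv_letter k"] Cons.prems
    by (simp add: reduced_foldr)
  then show ?case
    using Cons by simp
qed simp

lemma group_free_group: "group (free_group S)"
proof (rule groupI)
  fix w assume w: "w \<in> carrier (free_group S)"
  define v where "v = foldr cons_reduce (map inv_letter (rev w)) []"
  have "v \<in> lists (S \<times> UNIV)"
    unfolding v_def using w
    by (intro lists_foldr) (force simp: free_group_def inv_letter_def)+
  moreover have "reduced v"
    unfolding v_def by (simp add: reduced_foldr)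
  moreover have "foldr cons_reduce v w = []"
  proof -
    have rw: "reduced w"
      using w by (simp add: free_group_def)
    then have "foldr cons_reduce v w = foldr cons_reduce (map inv_letter (rev w)) w"
      by (simp add: v_def foldr_assoc)
    also have "\<dots> = []"
      using foldr_inverse[of "[]" w] rw by (simp add: foldr_reduced_Nil)
    finally show ?thesis .
  qed
  ultimately show "\<exists>y\<in>carrier (free_group S). y \<otimes>\<^bsub>free_group S\<^esub> w = \<one>\<^bsub>free_group S\<^esub>"
    by (auto simp: free_group_def)
qed (simp_all add: free_group_def foldr_assoc reduced_foldr lists_foldr del: in_lists_conv_set)

section \<open>Polynomial maps\<close>

definition diff_op ::
  "('a, 'c) monoid_scheme \<Rightarrow> ('b, 'd) monoid_scheme \<Rightarrow> 'a \<Rightarrow> ('a \<Rightarrow> 'b) \<Rightarrow> 'a \<Rightarrow> 'b" where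
  "diff_op G H g f = (\<lambda>x. f (g \<otimes>\<^bsub>G\<^esub> x) \<otimes>\<^bsub>H\<^esub> inv\<^bsub>H\<^esub> f x)"

text \<open>\<open>diff_ops G H [g\<^sub>1, \<dots>, g\<^sub>k] f\<close> applies the operator of \<open>g\<^sub>k\<close> first and that of
  \<open>g\<^sub>1\<close> last.\<close>

definition diff_ops ::
  "('a, 'c) monoid_scheme \<Rightarrow> ('b, 'd) monoid_scheme \<Rightarrow> 'a list \<Rightarrow> ('a \<Rightarrow> 'b) \<Rightarrow> 'a \<Rightarrow> 'b" where
  "diff_ops G H gs f = foldr (diff_op G H) gs f"

definition polynomial_map ::
  "('a, 'c) monoid_scheme \<Rightarrow> ('b, 'd) monoid_scheme \<Rightarrow> nat \<Rightarrow> ('a \<Rightarrow> 'b) \<Rightarrow> bool" where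
  "polynomial_map G H s f \<longleftrightarrow> f \<in> carrier G \<rightarrow> carrier H \<and>
     (\<forall>gs. gs \<in> lists (carrier G) \<and> length gs = s + 1 \<longrightarrow>
       (\<forall>x \<in> carrier G. diff_ops G H gs f x = \<one>\<^bsub>H\<^esub>))"

definition unital :: "('a, 'c) monoid_scheme \<Rightarrow> ('b, 'd) monoid_scheme \<Rightarrow> ('a \<Rightarrow> 'b) \<Rightarrow> bool" where
  "unital G H f \<longleftrightarrow> f \<one>\<^bsub>G\<^esub> = \<one>\<^bsub>H\<^esub>"

section \<open>The universal polynomial group\<close>

definition normal_closure :: "('a, 'c) monoid_scheme \<Rightarrow> 'a set \<Rightarrow> 'a set" where
  "normal_closure G A = \<Inter> {N. N \<lhd> G \<and> A \<subseteq> N}"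

lemma (in group) normal_normal_closure:
  assumes "A \<subseteq> carrier G"
  shows "normal_closure G A \<lhd> G"
proof -
  let ?NS = "{N. N \<lhd> G \<and> A \<subseteq> N}"
  have "carrier G \<in> ?NS"
    using assms normal_self by simp
  then have "subgroup (\<Inter> ?NS) G"
    by (intro subgroups_Inter) (auto dest: normal_imp_subgroup)
  moreover have "x \<otimes> h \<otimes> inv x \<in> \<Inter> ?NS" if "x \<in> carrier G" "h \<in> \<Inter> ?NS" for x h
    using that by (auto intro: normal.inv_op_closed2)
  ultimately show ?thesis
    unfolding normal_closure_def normal_inv_iff by blast
qed

definition free_on :: "('a, 'c) monoid_scheme \<Rightarrow> ('a \<times> bool) list monoid" where
  "free_on G = free_group (carrier G - {\<one>\<^bsub>G\<^esub>})"

definition free_incl :: "('a, 'c) monoid_scheme \<Rightarrow> 'a \<Rightarrow> ('a \<times> bool) list" where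
  "free_incl G g = (if g = \<one>\<^bsub>G\<^esub> then [] else [(g, True)])"

definition pol_relations :: "nat \<Rightarrow> ('a, 'c) monoid_scheme \<Rightarrow> ('a \<times> bool) list set" where
  "pol_relations s G = normal_closure (free_on G)
     {diff_ops G (free_on G) gs (free_incl G) \<one>\<^bsub>G\<^esub> | gs.
       gs \<in> lists (carrier G) \<and> length gs = s + 1}"

definition Pol :: "nat \<Rightarrow> ('a, 'c) monoid_scheme \<Rightarrow> ('a \<times> bool) list set monoid" where
  "Pol s G = free_on G Mod pol_relations s G"

section \<open>Stability\<close>

text \<open>\<open>Sym(n)\<close> is the library's \<^const>\<open>sym_group\<close>, which acts on \<open>{1..n}\<close>.\<close>

definition hamming_dist :: "nat \<Rightarrow> (nat \<Rightarrow> nat) \<Rightarrow> (nat \<Rightarrow> nat) \<Rightarrow> real" where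
  "hamming_dist n \<sigma> \<tau> =
     1 - 1 / real n * real (card {i \<in> {1..n}. (inv\<^bsub>sym_group n\<^esub> \<sigma> \<otimes>\<^bsub>sym_group n\<^esub> \<tau>) i = i})"

definition sym_maps ::
  "('a, 'c) monoid_scheme \<Rightarrow> (nat \<Rightarrow> nat) \<Rightarrow> (nat \<Rightarrow> 'a \<Rightarrow> nat \<Rightarrow> nat) \<Rightarrow> bool" where
  "sym_maps G m f \<longleftrightarrow>
     (\<forall>n. m n > 0) \<and> (\<forall>n. f n \<in> carrier G \<rightarrow> carrier (sym_group (m n)))"

definition asymp_close ::
  "('a, 'c) monoid_scheme \<Rightarrow> (nat \<Rightarrow> nat) \<Rightarrow> (nat \<Rightarrow> 'a \<Rightarrow> nat \<Rightarrow> nat) \<Rightarrow> (nat \<Rightarrow> 'a \<Rightarrow> nat \<Rightarrow> nat) \<Rightarrow> bool"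
  where
  "asymp_close G m \<rho> f \<longleftrightarrow>
     (\<forall>g \<in> carrier G. (\<lambda>n. hamming_dist (m n) (\<rho> n g) (f n g)) \<longlonglongrightarrow> 0)"

definition almost_hom ::
  "('a, 'c) monoid_scheme \<Rightarrow> (nat \<Rightarrow> nat) \<Rightarrow> (nat \<Rightarrow> 'a \<Rightarrow> nat \<Rightarrow> nat) \<Rightarrow> bool" where
  "almost_hom G m f \<longleftrightarrow> sym_maps G m f \<and>
     (\<forall>g \<in> carrier G. \<forall>h \<in> carrier G.
       (\<lambda>n. hamming_dist (m n) (f n g \<otimes>\<^bsub>sym_group (m n)\<^esub> f n h) (f n (g \<otimes>\<^bsub>G\<^esub> h))) \<longlonglongrightarrow> 0)"

definition P_stable :: "('a, 'c) monoid_scheme \<Rightarrow> bool" where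
  "P_stable G \<longleftrightarrow> (\<forall>m f. almost_hom G m f \<longrightarrow>
     (\<exists>\<rho>. (\<forall>n. \<rho> n \<in> hom G (sym_group (m n))) \<and> asymp_close G m \<rho> f))"

definition asymp_unital ::
  "('a, 'c) monoid_scheme \<Rightarrow> (nat \<Rightarrow> nat) \<Rightarrow> (nat \<Rightarrow> 'a \<Rightarrow> nat \<Rightarrow> nat) \<Rightarrow> bool" where
  "asymp_unital G m f \<longleftrightarrow> sym_maps G m f \<and>
     (\<lambda>n. hamming_dist (m n) (f n \<one>\<^bsub>G\<^esub>) \<one>\<^bsub>sym_group (m n)\<^esub>) \<longlonglongrightarrow> 0"

definition almost_polynomial ::
  "nat \<Rightarrow> ('a, 'c) monoid_scheme \<Rightarrow> (nat \<Rightarrow> nat) \<Rightarrow> (nat \<Rightarrow> 'a \<Rightarrow> nat \<Rightarrow> nat) \<Rightarrow> bool" where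
  "almost_polynomial s G m f \<longleftrightarrow> asymp_unital G m f \<and>
     (\<forall>gs. gs \<in> lists (carrier G) \<and> length gs = s + 1 \<longrightarrow>
       (\<lambda>n. hamming_dist (m n) (diff_ops G (sym_group (m n)) gs (f n) \<one>\<^bsub>G\<^esub>)
              \<one>\<^bsub>sym_group (m n)\<^esub>) \<longlonglongrightarrow> 0)"

definition poly_P_stable :: "nat \<Rightarrow> ('a, 'c) monoid_scheme \<Rightarrow> bool" where
  "poly_P_stable s G \<longleftrightarrow> (\<forall>m f. almost_polynomial s G m f \<longrightarrow>
     (\<exists>\<rho>. (\<forall>n. unital G (sym_group (m n)) (\<rho> n) \<and> polynomial_map G (sym_group (m n)) s (\<rho> n)) \<and>
          asymp_close G m \<rho> f))"

end

theory Submission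
  imports Defs "HOL-Algebra.Product_Groups"
begin

text \<open>Fix degrees \<open>m\<^sub>n\<close>, let \<open>P\<close> be the product of the groups \<open>Sym(m\<^sub>n)\<close> and \<open>N\<close> the normal
  subgroup of the sequences that tend to the identity in the Hamming distance. Almost-homomorphisms
  of \<open>\<Gamma>\<close> are the homomorphisms \<open>\<Gamma> \<rightarrow> P/N\<close>, and almost-polynomial sequences on \<open>G\<close> are the
  unital polynomial maps \<open>G \<rightarrow> P/N\<close>. Both stability notions say that such maps lift along
  \<open>P \<rightarrow> P/N\<close>. Unital polynomial maps out of \<open>G\<close> correspond naturally to homomorphisms out of
  \<open>Pol\<^sub>s(G)\<close>, so the two lifting problems are equivalent.\<close>

section \<open>Polynomial maps\<close>

lemma diff_ops_closed:
  assumes "group G" "group H" "f \<in> carrier G \<rightarrow> carrier H" "gs \<in> lists (carrier G)"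
  shows "diff_ops G H gs f \<in> carrier G \<rightarrow> carrier H"
  using assms(4)
proof (induction gs)
  case Nil
  then show ?case using assms by (simp add: diff_ops_def)
next
  case (Cons g gs)
  interpret G: group G by fact
  interpret H: group H by fact
  have IH: "diff_ops G H gs f \<in> carrier G \<rightarrow> carrier H"
    using Cons by simp
  show ?case
  proof
    fix x assume "x \<in> carrier G"
    then have "diff_ops G H gs f (g \<otimes>\<^bsub>G\<^esub> x) \<in> carrier H" "diff_ops G H gs f x \<in> carrier H"
      using IH Cons.hyps by (auto simp: Pi_iff)
    then show "diff_ops G H (g # gs) f x \<in> carrier H"
      by (simp add: diff_ops_def diff_op_def)
  qed
qed

text \<open>Naturality of the difference operators: they are built from products and inverses in the
  target, which \<open>h\<close> preserves. The map \<open>f'\<close> is kept separate from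
  \<open>h\<close> composed with \<open>f\<close>, so that agreement on the carrier of
  \<open>G\<close> suffices; with \<open>h\<close> the identity, this also exchanges maps that
  differ off the carrier.\<close>

lemma diff_ops_hom:
  assumes "group G" "group H" "group K" "h \<in> hom H K"
    and "f \<in> carrier G \<rightarrow> carrier H" "gs \<in> lists (carrier G)"
    and "\<And>x. x \<in> carrier G \<Longrightarrow> f' x = h (f x)" "x \<in> carrier G"
  shows "diff_ops G K gs f' x = h (diff_ops G H gs f x)"
  using assms(6,8)
proof (induction gs arbitrary: x)
  case Nil
  then show ?case using assms by (simp add: diff_ops_def)
next
  case (Cons g gs)
  interpret G: group G by fact
  interpret h: group_hom H K h
    using assms by (simp add: group_hom_def group_hom_axioms_def)
  have IH: "diff_ops G K gs f' y = h (diff_ops G H gs f y)" "diff_ops G H gs f y \<in> carrier H"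
    if "y \<in> carrier G" for y
    using Cons that diff_ops_closed[OF assms(1,2,5), of gs] by auto
  have "g \<otimes>\<^bsub>G\<^esub> x \<in> carrier G"
    using Cons by simp
  then have "h (diff_ops G H gs f (g \<otimes>\<^bsub>G\<^esub> x) \<otimes>\<^bsub>H\<^esub> inv\<^bsub>H\<^esub> diff_ops G H gs f x) =
      diff_ops G K gs f' (g \<otimes>\<^bsub>G\<^esub> x) \<otimes>\<^bsub>K\<^esub> inv\<^bsub>K\<^esub> diff_ops G K gs f' x"
    using IH Cons.prems by simp
  then show ?case
    by (simp add: diff_ops_def diff_op_def)
qed

text \<open>Induction on \<open>s\<close>, with \<open>f\<close> varying. In degree 0 a trivial
  difference at the identity says that \<open>f y\<close> equals \<open>f\<close> at the identity,
  so \<open>f\<close> is constant and its differences vanish everywhere. In the step,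
  \<open>diff_op G H g f\<close> inherits the condition at the identity in one degree less.\<close>

lemma polynomial_map_iff_at_one:
  assumes "group G" "group H" "f \<in> carrier G \<rightarrow> carrier H"
  shows "polynomial_map G H s f \<longleftrightarrow>
    (\<forall>gs. gs \<in> lists (carrier G) \<and> length gs = s + 1 \<longrightarrow> diff_ops G H gs f \<one>\<^bsub>G\<^esub> = \<one>\<^bsub>H\<^esub>)"
proof -
  interpret G: group G by fact
  interpret H: group H by fact
  have "diff_ops G H gs f x = \<one>\<^bsub>H\<^esub>"
    if "\<forall>gs. gs \<in> lists (carrier G) \<and> length gs = s + 1 \<longrightarrow> diff_ops G H gs f \<one>\<^bsub>G\<^esub> = \<one>\<^bsub>H\<^esub>"
      "gs \<in> lists (carrier G)" "length gs = s + 1" "x \<in> carrier G" for gs x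
    using assms(3) that
  proof (induction s arbitrary: f gs)
    case 0
    have const: "f y = f \<one>\<^bsub>G\<^esub>" if y: "y \<in> carrier G" for y
    proof -
      have "f y \<otimes>\<^bsub>H\<^esub> inv\<^bsub>H\<^esub> f \<one>\<^bsub>G\<^esub> = \<one>\<^bsub>H\<^esub>"
        using 0(2)[rule_format, of "[y]"] y by (simp add: diff_ops_def diff_op_def)
      moreover have "f y \<in> carrier H" "f \<one>\<^bsub>G\<^esub> \<in> carrier H"
        using 0(1) y by auto
      ultimately show ?thesis
        by (metis H.inv_closed H.r_inv H.right_cancel)
    qed
    obtain g where g: "gs = [g]" "g \<in> carrier G"
      using 0(3,4) by (auto simp: length_Suc_conv)
    have "f \<one>\<^bsub>G\<^esub> \<in> carrier H"
      using 0(1) by auto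
    then show ?case
      using g const[of x] const[of "g \<otimes>\<^bsub>G\<^esub> x"] 0(5) by (simp add: diff_ops_def diff_op_def)
  next
    case (Suc s)
    \<comment> \<open>The list is split at its end because the operator of the last entry is applied
      first: it can be absorbed into the map, leaving a shorter list of differences.\<close>
    obtain hs g where gs: "gs = hs @ [g]" "length hs = s + 1"
      using Suc.prems(4) by (cases gs rule: rev_cases) auto
    then have "g \<in> carrier G" "hs \<in> lists (carrier G)"
      using Suc.prems(3) by auto
    have snoc: "diff_ops G H (ks @ [g]) f = diff_ops G H ks (diff_op G H g f)" for ks
      by (simp add: diff_ops_def)
    have "diff_op G H g f \<in> carrier G \<rightarrow> carrier H"
      using diff_ops_closed[OF assms(1,2) Suc.prems(1), of "[g]"] \<open>g \<in> carrier G\<close>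
      by (simp add: diff_ops_def)
    moreover have "diff_ops G H ks (diff_op G H g f) \<one>\<^bsub>G\<^esub> = \<one>\<^bsub>H\<^esub>"
      if "ks \<in> lists (carrier G) \<and> length ks = s + 1" for ks
      using Suc.prems(2)[rule_format, of "ks @ [g]"] that \<open>g \<in> carrier G\<close> by (simp add: snoc)
    ultimately have "diff_ops G H hs (diff_op G H g f) x = \<one>\<^bsub>H\<^esub>"
      using Suc.IH[of "diff_op G H g f" hs] Suc.prems(5) gs \<open>hs \<in> lists (carrier G)\<close> by blast
    then show ?case
      by (simp add: gs snoc)
  qed
  then show ?thesis
    unfolding polynomial_map_def by (intro iffI conjI assms(3) allI impI ballI) simp_all
qed

lemma unital_polynomial_hom_comp:
  assumes "group G" "group H" "group K" "h \<in> hom H K"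
    and "unital G H f" "polynomial_map G H s f"
  shows "unital G K (\<lambda>x. h (f x))" "polynomial_map G K s (\<lambda>x. h (f x))"
proof -
  interpret h: group_hom H K h
    using assms by (simp add: group_hom_def group_hom_axioms_def)
  show "unital G K (\<lambda>x. h (f x))"
    using assms(5) by (simp add: unital_def)
  have "f \<in> carrier G \<rightarrow> carrier H"
    using assms(6) by (simp add: polynomial_map_def)
  then show "polynomial_map G K s (\<lambda>x. h (f x))"
    using assms(6) diff_ops_hom[OF assms(1-4), of f _ "\<lambda>x. h (f x)"]
    unfolding polynomial_map_def by (auto simp: Pi_iff)
qed

section \<open>The universal property of the universal polynomial group\<close>

text \<open>\<open>F\<close> multiplies out the values of the letters of any word, reduced or not.
  Cancelling a letter against its inverse does not change this product, so \<open>F\<close> respects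
  \<open>cons_reduce\<close>, and by induction on the left factor also the multiplication of reduced
  words.\<close>

lemma free_group_extend:
  assumes "group H" "u \<in> S \<rightarrow> carrier H"
  obtains F where "F \<in> hom (free_group S) H" "\<And>x. x \<in> S \<Longrightarrow> F [(x, True)] = u x"
proof -
  interpret H: group H by fact
  define e where "e l = (if snd l then u (fst l) else inv\<^bsub>H\<^esub> u (fst l))" for l
  define F where "F w = foldr (\<lambda>l y. e l \<otimes>\<^bsub>H\<^esub> y) w \<one>\<^bsub>H\<^esub>" for w
  have e: "e l \<in> carrier H" if "l \<in> S \<times> UNIV" for l
    using that assms by (auto simp: e_def)
  have e_inv: "e (inv_letter l) = inv\<^bsub>H\<^esub> e l" if "l \<in> S \<times> UNIV" for l
    using that assms by (auto simp: e_def inv_letter_def Pi_iff)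
  have F: "F w \<in> carrier H" if "w \<in> lists (S \<times> UNIV)" for w
    using that by (induction w) (auto simp: F_def intro!: e H.m_closed)
  have F_cons: "F (cons_reduce k w) = e k \<otimes>\<^bsub>H\<^esub> F w"
    if "k \<in> S \<times> UNIV" "w \<in> lists (S \<times> UNIV)" for k w
  proof (cases "\<exists>v. w = inv_letter k # v")
    case True
    then obtain v where w: "w = inv_letter k # v" by blast
    then have v: "v \<in> lists (S \<times> UNIV)"
      using that by simp
    have "e k \<otimes>\<^bsub>H\<^esub> F w = e k \<otimes>\<^bsub>H\<^esub> (inv\<^bsub>H\<^esub> e k \<otimes>\<^bsub>H\<^esub> F v)"
      using that(1) by (simp add: w F_def e_inv)
    also have "\<dots> = F v"
      using e[OF that(1)] F[OF v] by (simp flip: H.m_assoc)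
    finally show ?thesis by (simp add: w)
  next
    case False
    then have "cons_reduce k w = k # w"
      by (cases w) auto
    then show ?thesis by (simp add: F_def)
  qed
  have F_mult: "F (foldr cons_reduce v w) = F v \<otimes>\<^bsub>H\<^esub> F w"
    if "v \<in> lists (S \<times> UNIV)" "w \<in> lists (S \<times> UNIV)" for v w
    using that(1)
  proof (induction v)
    case Nil
    then show ?case using F[OF that(2)] by (simp add: F_def)
  next
    case (Cons k v)
    then have k: "k \<in> S \<times> UNIV" "v \<in> lists (S \<times> UNIV)"
      by auto
    have "F (foldr cons_reduce (k # v) w) = e k \<otimes>\<^bsub>H\<^esub> (F v \<otimes>\<^bsub>H\<^esub> F w)"
      using F_cons[OF k(1) lists_foldr[OF k(2) that(2)]] Cons by simp
    also have "\<dots> = F (k # v) \<otimes>\<^bsub>H\<^esub> F w"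
      using e[OF k(1)] F[OF k(2)] F[OF that(2)] H.m_assoc by (simp add: F_def)
    finally show ?case .
  qed
  have "F \<in> hom (free_group S) H"
    using F F_mult by (auto simp: hom_def free_group_def simp del: in_lists_conv_set)
  moreover have "F [(x, True)] = u x" if "x \<in> S" for x
    using that assms by (auto simp: F_def e_def Pi_iff)
  ultimately show thesis
    using that by blast
qed

text \<open>A reduced word is the product of its one-letter words, and a negative letter is the
  group inverse of the positive one, so the values on positive letters decide everything.\<close>

lemma free_group_hom_eqI:
  assumes "group H" "F \<in> hom (free_group S) H" "F' \<in> hom (free_group S) H"
    and gen: "\<And>x. x \<in> S \<Longrightarrow> F [(x, True)] = F' [(x, True)]"
    and "w \<in> carrier (free_group S)"
  shows "F w = F' w"
proof -
  interpret F: group_hom "free_group S" H F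
    using assms by (simp add: group_hom_def group_hom_axioms_def group_free_group)
  interpret F': group_hom "free_group S" H F'
    using assms by (simp add: group_hom_def group_hom_axioms_def group_free_group)
  have letter: "F [l] = F' [l]" if l_in: "l \<in> S \<times> UNIV" for l
  proof -
    obtain x b where l: "l = (x, b)" "x \<in> S"
      using l_in by (cases l) auto
    have x: "[(x, c)] \<in> carrier (free_group S)" for c
      using l by (simp add: free_group_def reduced_Cons)
    have "[(x, False)] \<otimes>\<^bsub>free_group S\<^esub> [(x, True)] = \<one>\<^bsub>free_group S\<^esub>"
      by (simp add: free_group_def inv_letter_def)
    then have inv: "[(x, False)] = inv\<^bsub>free_group S\<^esub> [(x, True)]"
      by (rule group.inv_equality[OF group_free_group _ x x, symmetric])
    show ?thesis
    proof (cases b)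
      case True
      then show ?thesis
        using gen[OF l(2)] l(1) by simp
    next
      case False
      then show ?thesis
        unfolding l(1) using gen[OF l(2)] F.hom_inv[OF x] F'.hom_inv[OF x] by (simp add: inv)
    qed
  qed
  show ?thesis
    using assms(5)
  proof (induction w)
    case Nil
    have "[] = \<one>\<^bsub>free_group S\<^esub>"
      by (simp add: free_group_def)
    then show ?case
      using F.hom_one F'.hom_one by metis
  next
    case (Cons k w)
    then have "w \<in> carrier (free_group S)" "k \<in> S \<times> UNIV" "[k] \<in> carrier (free_group S)"
      by (auto simp: free_group_def reduced_Cons)
    \<comment> \<open>Because \<open>k # w\<close> is reduced, no cancellation occurs, and
      prepending a letter is multiplication by its one-letter word.\<close>
    moreover have "k # w = [k] \<otimes>\<^bsub>free_group S\<^esub> w"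
      using Cons.prems by (simp add: free_group_def cons_reduce_reduced)
    ultimately show ?case
      using Cons.IH letter[of k] F.hom_mult F'.hom_mult by metis
  qed
qed

section \<open>The generator map of \<open>Pol s G\<close> and its universal property\<close>

lemma free_incl_closed: "free_incl G \<in> carrier G \<rightarrow> carrier (free_on G)"
  by (auto simp: free_incl_def free_on_def free_group_def reduced_Cons)

lemma group_free_on: "group (free_on G)"
  by (simp add: free_on_def group_free_group)

text \<open>Needed to know that \<open>pol_relations\<close> is normal:
  \<open>normal_normal_closure\<close> asks for a subset of the carrier.\<close>

lemma pol_relators_closed:
  assumes "group G"
  shows "{diff_ops G (free_on G) gs (free_incl G) \<one>\<^bsub>G\<^esub> | gs.
    gs \<in> lists (carrier G) \<and> length gs = s + 1} \<subseteq> carrier (free_on G)"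
proof -
  have "diff_ops G (free_on G) gs (free_incl G) \<one>\<^bsub>G\<^esub> \<in> carrier (free_on G)"
    if "gs \<in> lists (carrier G)" for gs
    using diff_ops_closed[OF assms group_free_on free_incl_closed that]
      monoid.one_closed[OF group.is_monoid[OF assms]] by (rule funcset_mem)
  then show ?thesis
    by blast
qed

lemma pol_relations_normal:
  assumes "group G"
  shows "pol_relations s G \<lhd> free_on G"
  unfolding pol_relations_def
  by (rule group.normal_normal_closure[OF group_free_on pol_relators_closed[OF assms]])

lemma group_Pol: "group G \<Longrightarrow> group (Pol s G)"
  unfolding Pol_def by (intro normal.factorgroup_is_group pol_relations_normal)

text \<open>This is the universal unital polynomial map of degree at most \<open>s\<close> on
  \<open>G\<close>: the generator map followed by the projection onto the quotient.\<close>

definition pol_incl :: "nat \<Rightarrow> ('a, 'c) monoid_scheme \<Rightarrow> 'a \<Rightarrow> ('a \<times> bool) list set" where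
  "pol_incl s G g = pol_relations s G #>\<^bsub>free_on G\<^esub> free_incl G g"

text \<open>By naturality the differences of \<open>pol_incl\<close> at the identity are the cosets
  of the relators, hence trivial. The relators constrain differences at the identity only;
  \<open>polynomial_map_iff_at_one\<close> extends this to all points.\<close>

lemma pol_incl_unital_polynomial:
  assumes "group G"
  shows "unital G (Pol s G) (pol_incl s G)" "polynomial_map G (Pol s G) s (pol_incl s G)"
proof -
  interpret G: group G by fact
  interpret normal "pol_relations s G" "free_on G"
    by (rule pol_relations_normal[OF assms])
  have hom: "(\<lambda>w. pol_relations s G #>\<^bsub>free_on G\<^esub> w) \<in> hom (free_on G) (Pol s G)"
    unfolding Pol_def by (rule r_coset_hom_Mod)
  have closed: "pol_incl s G \<in> carrier G \<rightarrow> carrier (Pol s G)"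
    unfolding pol_incl_def by (intro funcsetI hom_in_carrier[OF hom] funcset_mem[OF free_incl_closed])
  have "free_incl G \<one>\<^bsub>G\<^esub> = \<one>\<^bsub>free_on G\<^esub>"
    by (simp add: free_incl_def free_on_def free_group_def)
  then show "unital G (Pol s G) (pol_incl s G)"
    unfolding unital_def pol_incl_def
    using hom_one[OF hom group_free_on group_Pol[OF assms]] by (simp only:)
  have "diff_ops G (Pol s G) gs (pol_incl s G) \<one>\<^bsub>G\<^esub> = \<one>\<^bsub>Pol s G\<^esub>"
    if gs: "gs \<in> lists (carrier G)" "length gs = s + 1" for gs
  proof -
    have "diff_ops G (free_on G) gs (free_incl G) \<one>\<^bsub>G\<^esub> \<in> pol_relations s G"
      using gs unfolding pol_relations_def normal_closure_def by blast
    then have "pol_relations s G #>\<^bsub>free_on G\<^esub> diff_ops G (free_on G) gs (free_incl G) \<one>\<^bsub>G\<^esub> =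
        \<one>\<^bsub>Pol s G\<^esub>"
      by (simp add: rcos_const Pol_def group_free_on)
    then show ?thesis
      using diff_ops_hom[OF assms group_free_on group_Pol[OF assms] hom free_incl_closed gs(1)
          pol_incl_def G.one_closed] by simp
  qed
  then show "polynomial_map G (Pol s G) s (pol_incl s G)"
    using polynomial_map_iff_at_one[OF assms group_Pol[OF assms] closed] by blast
qed

text \<open>Existence half of the universal property. Extend \<open>u\<close> to \<open>F\<close> on
  the free group; by naturality \<open>F\<close> sends each relator to a difference of
  \<open>u\<close> at the identity, which is trivial, so \<open>F\<close> factors through the
  quotient.\<close>

lemma Pol_extend:
  assumes "group G" "group H" "unital G H u" "polynomial_map G H s u"
  obtains h where "h \<in> hom (Pol s G) H" "\<And>g. g \<in> carrier G \<Longrightarrow> h (pol_incl s G g) = u g"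
proof -
  interpret G: group G by fact
  have u: "u \<in> carrier G \<rightarrow> carrier H"
    using assms(4) by (simp add: polynomial_map_def)
  obtain F where F: "F \<in> hom (free_on G) H"
    "\<And>x. x \<in> carrier G - {\<one>\<^bsub>G\<^esub>} \<Longrightarrow> F [(x, True)] = u x"
    using free_group_extend[OF assms(2), of u "carrier G - {\<one>\<^bsub>G\<^esub>}"] u
    unfolding free_on_def by (auto simp: Pi_iff)
  interpret F: group_hom "free_on G" H F
    using assms(2) F(1) by (simp add: group_hom_def group_hom_axioms_def group_free_on)
  have "F [] = \<one>\<^bsub>H\<^esub>"
    using F.hom_one by (simp add: free_on_def free_group_def)
  \<comment> \<open>The free extension controls only the nontrivial elements of \<open>G\<close>. At
    the identity the generator is the empty word, and there unitality of \<open>u\<close> gives the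
    equation.\<close>
  then have incl: "u g = F (free_incl G g)" if "g \<in> carrier G" for g
    using F(2) that assms(3) by (simp add: free_incl_def unital_def)
  have "F (diff_ops G (free_on G) gs (free_incl G) \<one>\<^bsub>G\<^esub>) = \<one>\<^bsub>H\<^esub>"
    if gs: "gs \<in> lists (carrier G)" "length gs = s + 1" for gs
  proof -
    have "diff_ops G H gs u \<one>\<^bsub>G\<^esub> = F (diff_ops G (free_on G) gs (free_incl G) \<one>\<^bsub>G\<^esub>)"
      by (rule diff_ops_hom[OF assms(1) group_free_on assms(2) F(1) free_incl_closed gs(1) incl G.one_closed])
    moreover have "diff_ops G H gs u \<one>\<^bsub>G\<^esub> = \<one>\<^bsub>H\<^esub>"
      using assms(4) gs G.one_closed unfolding polynomial_map_def by blast
    ultimately show ?thesis by simp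
  qed
  then have "{diff_ops G (free_on G) gs (free_incl G) \<one>\<^bsub>G\<^esub> | gs.
      gs \<in> lists (carrier G) \<and> length gs = s + 1} \<subseteq> kernel (free_on G) H F"
    using pol_relators_closed[OF assms(1), of s] unfolding kernel_def by blast
  \<comment> \<open>The kernel of \<open>F\<close> is one of the normal subgroups whose intersection
    defines the normal closure.\<close>
  then have "pol_relations s G \<subseteq> kernel (free_on G) H F"
    using F.normal_kernel unfolding pol_relations_def normal_closure_def by blast
  then obtain h where h: "h \<in> hom (Pol s G) H"
    "\<And>w. w \<in> carrier (free_on G) \<Longrightarrow> h (pol_relations s G #>\<^bsub>free_on G\<^esub> w) = F w"
    using F.FactGroup_universal_kernel[OF pol_relations_normal[OF assms(1)]]
    unfolding Pol_def by blast
  show thesis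
  proof
    show "h \<in> hom (Pol s G) H" by fact
    show "h (pol_incl s G g) = u g" if "g \<in> carrier G" for g
      using h(2)[OF funcset_mem[OF free_incl_closed that]] incl[OF that] by (simp add: pol_incl_def)
  qed
qed

text \<open>Uniqueness half of the universal property. Both maps are pulled back along the
  surjective coset map to the free group, where agreement on generators suffices.\<close>

lemma Pol_hom_eqI:
  assumes "group G" "group H" "h \<in> hom (Pol s G) H" "h' \<in> hom (Pol s G) H"
    and gen: "\<And>g. g \<in> carrier G \<Longrightarrow> h (pol_incl s G g) = h' (pol_incl s G g)"
    and "p \<in> carrier (Pol s G)"
  shows "h p = h' p"
proof -
  let ?c = "\<lambda>w. pol_relations s G #>\<^bsub>free_on G\<^esub> w"
  have c: "?c \<in> hom (free_on G) (Pol s G)"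
    unfolding Pol_def by (rule normal.r_coset_hom_Mod[OF pol_relations_normal[OF assms(1)]])
  obtain w where w: "w \<in> carrier (free_on G)" "p = ?c w"
    using assms(6) by (auto simp: Pol_def carrier_FactGroup)
  have "(h \<circ> ?c) w = (h' \<circ> ?c) w"
  proof (rule free_group_hom_eqI[OF assms(2)])
    show "h \<circ> ?c \<in> hom (free_group (carrier G - {\<one>\<^bsub>G\<^esub>})) H"
      "h' \<circ> ?c \<in> hom (free_group (carrier G - {\<one>\<^bsub>G\<^esub>})) H"
      using hom_compose[OF c] assms(3,4) by (simp_all add: free_on_def)
    show "w \<in> carrier (free_group (carrier G - {\<one>\<^bsub>G\<^esub>}))"
      using w by (simp add: free_on_def)
    show "(h \<circ> ?c) [(x, True)] = (h' \<circ> ?c) [(x, True)]" if "x \<in> carrier G - {\<one>\<^bsub>G\<^esub>}" for x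
      using gen[of x] that by (simp add: pol_incl_def free_incl_def)
  qed
  then show ?thesis
    by (simp add: w)
qed

text \<open>Composition with \<open>pol_incl\<close> turns homomorphisms out of
  \<open>Pol s G\<close> into unital polynomial maps, and \<open>Pol_extend\<close> goes back; both
  are compatible with \<open>q\<close>, so lifts on one side yield lifts on the other.\<close>

lemma Pol_lifting_iff:
  assumes "group G" "group P" "group U" "q \<in> hom P U"
  shows "(\<forall>u. unital G U u \<and> polynomial_map G U s u \<longrightarrow>
      (\<exists>r. unital G P r \<and> polynomial_map G P s r \<and> (\<forall>g \<in> carrier G. q (r g) = u g))) \<longleftrightarrow>
    (\<forall>h \<in> hom (Pol s G) U. \<exists>k \<in> hom (Pol s G) P. \<forall>p \<in> carrier (Pol s G). q (k p) = h p)"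
    (is "?poly \<longleftrightarrow> ?hom")
proof
  assume ?poly
  show ?hom
  proof
    fix h assume h: "h \<in> hom (Pol s G) U"
    \<comment> \<open>The polynomial map being lifted is \<open>h\<close> restricted along
      \<open>pol_incl\<close>.\<close>
    obtain r where r: "unital G P r" "polynomial_map G P s r"
      "\<And>g. g \<in> carrier G \<Longrightarrow> q (r g) = h (pol_incl s G g)"
      using \<open>?poly\<close> unital_polynomial_hom_comp[OF assms(1) group_Pol[OF assms(1)] assms(3) h
          pol_incl_unital_polynomial[OF assms(1)]] by meson
    obtain k where k: "k \<in> hom (Pol s G) P" "\<And>g. g \<in> carrier G \<Longrightarrow> k (pol_incl s G g) = r g"
      using Pol_extend[OF assms(1,2) r(1,2)] by blast
    \<comment> \<open>The lift is known to be correct only on the image of \<open>pol_incl\<close>;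
      uniqueness of extensions carries this to all of \<open>Pol s G\<close>.\<close>
    have "(q \<circ> k) p = h p" if "p \<in> carrier (Pol s G)" for p
      using hom_compose[OF k(1) assms(4)] h _ that
      by (rule Pol_hom_eqI[OF assms(1,3)]) (simp add: k r)
    then show "\<exists>k \<in> hom (Pol s G) P. \<forall>p \<in> carrier (Pol s G). q (k p) = h p"
      using k(1) by auto
  qed
next
  assume ?hom
  show ?poly
  proof (intro allI impI)
    fix u assume "unital G U u \<and> polynomial_map G U s u"
    then obtain h where h: "h \<in> hom (Pol s G) U" "\<And>g. g \<in> carrier G \<Longrightarrow> h (pol_incl s G g) = u g"
      using Pol_extend[OF assms(1,3)] by blast
    then obtain k where k: "k \<in> hom (Pol s G) P" "\<And>p. p \<in> carrier (Pol s G) \<Longrightarrow> q (k p) = h p"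
      using \<open>?hom\<close> by blast
    have "pol_incl s G \<in> carrier G \<rightarrow> carrier (Pol s G)"
      using pol_incl_unital_polynomial[OF assms(1)] by (simp add: polynomial_map_def)
    then show "\<exists>r. unital G P r \<and> polynomial_map G P s r \<and> (\<forall>g \<in> carrier G. q (r g) = u g)"
      using unital_polynomial_hom_comp[OF assms(1) group_Pol[OF assms(1)] assms(2) k(1)
          pol_incl_unital_polynomial[OF assms(1)]] h(2) k(2)
      by (intro exI[of _ "\<lambda>g. k (pol_incl s G g)"]) (auto simp: Pi_iff)
  qed
qed

section \<open>Sequences of permutations modulo null sequences\<close>

text \<open>A fixed point of the inverse of \<open>\<sigma>\<close> times \<open>\<tau>\<close> is a
  point where the two agree, so one minus the proportion of agreement counts disagreement. For
  \<open>n = 0\<close> the left side would be 1 and the right side 0.\<close>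

lemma hamming_dist_eq:
  assumes "n > 0" "\<sigma> permutes {1..n}" "\<tau> permutes {1..n}"
  shows "hamming_dist n \<sigma> \<tau> = real (card {i \<in> {1..n}. \<sigma> i \<noteq> \<tau> i}) / real n"
proof -
  have "inv\<^bsub>sym_group n\<^esub> \<sigma> = Hilbert_Choice.inv \<sigma>"
    using assms by (simp add: sym_group_carrier)
  then have "(inv\<^bsub>sym_group n\<^esub> \<sigma> \<otimes>\<^bsub>sym_group n\<^esub> \<tau>) i = i \<longleftrightarrow> \<sigma> i = \<tau> i" for i
    using permutes_inv_eq[OF assms(2)] by (auto simp: sym_group_mult)
  then have "hamming_dist n \<sigma> \<tau> = 1 - real (card {i \<in> {1..n}. \<sigma> i = \<tau> i}) / real n"
    by (simp add: hamming_dist_def)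
  moreover have "n = card {i \<in> {1..n}. \<sigma> i = \<tau> i} + card {i \<in> {1..n}. \<sigma> i \<noteq> \<tau> i}"
    using card_Int_Diff[of "{1..n}" "{i. \<sigma> i = \<tau> i}"]
    by (simp add: Int_def set_diff_eq)
  then have "real n = real (card {i \<in> {1..n}. \<sigma> i = \<tau> i}) + real (card {i \<in> {1..n}. \<sigma> i \<noteq> \<tau> i})"
    by linarith
  ultimately show ?thesis
    using assms(1) by (simp add: field_simps)
qed

lemma hamming_dist_nonneg:
  assumes "n > 0" "\<sigma> permutes {1..n}" "\<tau> permutes {1..n}"
  shows "0 \<le> hamming_dist n \<sigma> \<tau>"
  by (simp add: hamming_dist_eq[OF assms])

text \<open>\<open>\<pi>\<close> maps the disagreement set of the composites bijectively onto that
  of \<open>\<sigma>\<close> and \<open>\<tau>\<close>.\<close>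

lemma hamming_dist_right_invariant:
  assumes "n > 0" "\<sigma> permutes {1..n}" "\<tau> permutes {1..n}" "\<pi> permutes {1..n}"
  shows "hamming_dist n (\<sigma> \<circ> \<pi>) (\<tau> \<circ> \<pi>) = hamming_dist n \<sigma> \<tau>"
proof -
  have "bij_betw \<pi> {i \<in> {1..n}. (\<sigma> \<circ> \<pi>) i \<noteq> (\<tau> \<circ> \<pi>) i} {i \<in> {1..n}. \<sigma> i \<noteq> \<tau> i}"
    using permutes_imp_bij[OF assms(4)]
    by (rule bij_betw_Collect) simp
  then have "card {i \<in> {1..n}. (\<sigma> \<circ> \<pi>) i \<noteq> (\<tau> \<circ> \<pi>) i} = card {i \<in> {1..n}. \<sigma> i \<noteq> \<tau> i}"
    by (rule bij_betw_same_card)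
  then show ?thesis
    unfolding hamming_dist_eq[OF assms(1-3)]
      hamming_dist_eq[OF assms(1) permutes_compose[OF assms(4,2)] permutes_compose[OF assms(4,3)]]
    by (simp only:)
qed

text \<open>Since \<open>\<pi>\<close> is injective, the two disagreement sets coincide.\<close>

lemma hamming_dist_left_invariant:
  assumes "n > 0" "\<sigma> permutes {1..n}" "\<tau> permutes {1..n}" "\<pi> permutes {1..n}"
  shows "hamming_dist n (\<pi> \<circ> \<sigma>) (\<pi> \<circ> \<tau>) = hamming_dist n \<sigma> \<tau>"
  unfolding hamming_dist_eq[OF assms(1-3)]
    hamming_dist_eq[OF assms(1) permutes_compose[OF assms(2,4)] permutes_compose[OF assms(3,4)]]
  by (simp add: inj_eq[OF permutes_inj[OF assms(4)]])

text \<open>Where \<open>\<sigma>\<close> and \<open>\<pi>\<close> disagree, \<open>\<tau>\<close>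
  disagrees with at least one of them.\<close>

lemma hamming_dist_triangle:
  assumes "n > 0" "\<sigma> permutes {1..n}" "\<tau> permutes {1..n}" "\<pi> permutes {1..n}"
  shows "hamming_dist n \<sigma> \<pi> \<le> hamming_dist n \<sigma> \<tau> + hamming_dist n \<tau> \<pi>"
proof -
  have "card {i \<in> {1..n}. \<sigma> i \<noteq> \<pi> i} \<le>
      card ({i \<in> {1..n}. \<sigma> i \<noteq> \<tau> i} \<union> {i \<in> {1..n}. \<tau> i \<noteq> \<pi> i})"
    by (rule card_mono) auto
  also have "\<dots> \<le> card {i \<in> {1..n}. \<sigma> i \<noteq> \<tau> i} + card {i \<in> {1..n}. \<tau> i \<noteq> \<pi> i}"
    by (rule card_Un_le)
  finally have "real (card {i \<in> {1..n}. \<sigma> i \<noteq> \<pi> i}) \<le>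
      real (card {i \<in> {1..n}. \<sigma> i \<noteq> \<tau> i}) + real (card {i \<in> {1..n}. \<tau> i \<noteq> \<pi> i})"
    by linarith
  then show ?thesis
    unfolding hamming_dist_eq[OF assms(1-3)] hamming_dist_eq[OF assms(1,3,4)]
      hamming_dist_eq[OF assms(1,2,4)] add_divide_distrib[symmetric]
    by (intro divide_right_mono) simp_all
qed

lemma hamming_dist_commute:
  assumes "n > 0" "\<sigma> permutes {1..n}" "\<tau> permutes {1..n}"
  shows "hamming_dist n \<sigma> \<tau> = hamming_dist n \<tau> \<sigma>"
proof -
  have "{i \<in> {1..n}. \<sigma> i \<noteq> \<tau> i} = {i \<in> {1..n}. \<tau> i \<noteq> \<sigma> i}"
    by auto
  then show ?thesis
    by (simp only: hamming_dist_eq[OF assms] hamming_dist_eq[OF assms(1,3,2)])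
qed

section \<open>The product of the symmetric groups and its null sequences\<close>

definition seq_group :: "(nat \<Rightarrow> nat) \<Rightarrow> (nat \<Rightarrow> nat \<Rightarrow> nat) monoid" where
  "seq_group m = product_group UNIV (\<lambda>n. sym_group (m n))"

definition null_seqs :: "(nat \<Rightarrow> nat) \<Rightarrow> (nat \<Rightarrow> nat \<Rightarrow> nat) set" where
  "null_seqs m = {a \<in> carrier (seq_group m). (\<lambda>n. hamming_dist (m n) (a n) id) \<longlonglongrightarrow> 0}"

lemma group_seq_group: "group (seq_group m)"
  by (simp add: seq_group_def sym_group_is_group)

text \<open>Over the index set \<open>UNIV\<close> the extensionality condition of a product group
  is vacuous, so membership is purely coordinatewise.\<close>

lemma seq_group_carrier: "a \<in> carrier (seq_group m) \<longleftrightarrow> (\<forall>n. a n \<in> carrier (sym_group (m n)))"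
  by (auto simp: seq_group_def)

lemma seq_group_mult: "(a \<otimes>\<^bsub>seq_group m\<^esub> b) n = a n \<otimes>\<^bsub>sym_group (m n)\<^esub> b n"
  by (simp add: seq_group_def)

lemma seq_group_one: "\<one>\<^bsub>seq_group m\<^esub> n = \<one>\<^bsub>sym_group (m n)\<^esub>"
  by (simp add: seq_group_def)

lemma seq_group_inv:
  assumes "a \<in> carrier (seq_group m)"
  shows "(inv\<^bsub>seq_group m\<^esub> a) n = Hilbert_Choice.inv (a n)"
proof -
  have "(inv\<^bsub>seq_group m\<^esub> a) n = inv\<^bsub>sym_group (m n)\<^esub> a n"
    using assms by (simp add: seq_group_def inv_product_group sym_group_is_group)
  also have "\<dots> = Hilbert_Choice.inv (a n)"
    using assms by (intro sym_group_inv_equality) (simp add: seq_group_carrier)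
  finally show ?thesis .
qed

lemma seq_group_proj_hom: "(\<lambda>a. a n) \<in> hom (seq_group m) (sym_group (m n))"
  by (simp add: hom_def seq_group_carrier seq_group_mult)

text \<open>The universal property of the product. The arguments are swapped because the stability
  notions index families by \<open>n\<close> first, whereas a map into the product takes the group
  element first.\<close>

lemma hom_seq_group_iff:
  "(\<lambda>x n. \<rho> n x) \<in> hom G (seq_group m) \<longleftrightarrow> (\<forall>n. \<rho> n \<in> hom G (sym_group (m n)))"
  by (auto simp: hom_def seq_group_carrier seq_group_mult Pi_iff fun_eq_iff)

text \<open>Naturality along the coordinate projections, which are homomorphisms.\<close>

lemma diff_ops_seq_group:
  assumes "group G" "F \<in> carrier G \<rightarrow> carrier (seq_group m)" "gs \<in> lists (carrier G)"
    and "x \<in> carrier G"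
  shows "diff_ops G (seq_group m) gs F x n = diff_ops G (sym_group (m n)) gs (\<lambda>g. F g n) x"
  using diff_ops_hom[OF assms(1) group_seq_group sym_group_is_group seq_group_proj_hom assms(2,3) _ assms(4),
      of "\<lambda>g. F g n" n] by simp

lemma unital_polynomial_seq_group_iff:
  assumes "group G"
  shows "unital G (seq_group m) (\<lambda>g n. \<rho> n g) \<and> polynomial_map G (seq_group m) s (\<lambda>g n. \<rho> n g) \<longleftrightarrow>
    (\<forall>n. unital G (sym_group (m n)) (\<rho> n) \<and> polynomial_map G (sym_group (m n)) s (\<rho> n))"
proof -
  have closed: "(\<lambda>g n. \<rho> n g) \<in> carrier G \<rightarrow> carrier (seq_group m) \<longleftrightarrow>
      (\<forall>n. \<rho> n \<in> carrier G \<rightarrow> carrier (sym_group (m n)))"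
    by (auto simp: Pi_iff seq_group_carrier)
  have diff: "diff_ops G (seq_group m) gs (\<lambda>g n. \<rho> n g) x = \<one>\<^bsub>seq_group m\<^esub> \<longleftrightarrow>
      (\<forall>n. diff_ops G (sym_group (m n)) gs (\<rho> n) x = \<one>\<^bsub>sym_group (m n)\<^esub>)"
    if "(\<lambda>g n. \<rho> n g) \<in> carrier G \<rightarrow> carrier (seq_group m)" "gs \<in> lists (carrier G)"
      "x \<in> carrier G" for gs x
    using diff_ops_seq_group[OF assms that] by (simp add: fun_eq_iff seq_group_one)
  have "unital G (seq_group m) (\<lambda>g n. \<rho> n g) \<longleftrightarrow> (\<forall>n. unital G (sym_group (m n)) (\<rho> n))"
    by (auto simp: unital_def fun_eq_iff seq_group_one)
  moreover have "polynomial_map G (seq_group m) s (\<lambda>g n. \<rho> n g) \<longleftrightarrow>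
      (\<forall>n. polynomial_map G (sym_group (m n)) s (\<rho> n))"
    unfolding polynomial_map_def using closed diff by meson
  ultimately show ?thesis
    by blast
qed

text \<open>Bi-invariance of the metric does the work: right invariance and symmetry give inverses,
  right invariance and the triangle inequality give products, and invariance on both sides gives
  conjugates.\<close>

lemma null_seqs_normal:
  assumes pos: "\<forall>n. m n > 0"
  shows "null_seqs m \<lhd> seq_group m"
proof -
  interpret group "seq_group m" by (rule group_seq_group)
  have m: "m n > 0" for n
    using pos by blast
  have perm: "a n permutes {1..m n}" if "a \<in> carrier (seq_group m)" for a n
    using that by (simp add: seq_group_carrier sym_group_carrier)
  have id: "id permutes {1..m n}" for n
    by (rule permutes_id)
  have mult: "(a \<otimes>\<^bsub>seq_group m\<^esub> b) n = a n \<circ> b n" for a b n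
    by (simp add: seq_group_mult sym_group_mult)
  have "subgroup (null_seqs m) (seq_group m)"
  proof (rule subgroupI)
    show "null_seqs m \<subseteq> carrier (seq_group m)"
      by (auto simp: null_seqs_def)
    have "\<one>\<^bsub>seq_group m\<^esub> \<in> null_seqs m"
      using hamming_dist_eq[OF m id id] by (simp add: null_seqs_def seq_group_one sym_group_one)
    then show "null_seqs m \<noteq> {}" by blast
  next
    fix a assume a: "a \<in> null_seqs m"
    then have ac: "a \<in> carrier (seq_group m)" by (simp add: null_seqs_def)
    have "hamming_dist (m n) ((inv\<^bsub>seq_group m\<^esub> a) n) id = hamming_dist (m n) (a n) id" for n
    proof -
      note p = perm[OF ac, of n]
      have "hamming_dist (m n) (Hilbert_Choice.inv (a n)) id =
          hamming_dist (m n) (Hilbert_Choice.inv (a n) \<circ> a n) (id \<circ> a n)"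
        by (rule hamming_dist_right_invariant[OF m permutes_inv[OF p] id p, symmetric])
      also have "\<dots> = hamming_dist (m n) id (a n)"
        using permutes_inv_o(2)[OF p] by simp
      finally show ?thesis
        using hamming_dist_commute[OF m id p] by (simp add: seq_group_inv[OF ac])
    qed
    then show "inv\<^bsub>seq_group m\<^esub> a \<in> null_seqs m"
      using a by (simp add: null_seqs_def)
  next
    fix a b assume ab: "a \<in> null_seqs m" "b \<in> null_seqs m"
    then have c: "a \<in> carrier (seq_group m)" "b \<in> carrier (seq_group m)"
      by (simp_all add: null_seqs_def)
    \<comment> \<open>The triangle inequality passes through \<open>b n\<close>; right invariance
      turns the distance from the product to \<open>b n\<close> into the distance from
      \<open>a n\<close> to \<open>id\<close>.\<close>
    have bound: "hamming_dist (m n) (a n \<circ> b n) id \<le>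
        hamming_dist (m n) (a n) id + hamming_dist (m n) (b n) id" for n
      using hamming_dist_triangle[OF m permutes_compose[OF perm[OF c(2)] perm[OF c(1)]] perm[OF c(2)] id, of n]
        hamming_dist_right_invariant[OF m perm[OF c(1)] id perm[OF c(2)], of n]
      by simp
    have sum: "(\<lambda>n. hamming_dist (m n) (a n) id + hamming_dist (m n) (b n) id) \<longlonglongrightarrow> 0"
      using ab by (intro tendsto_add_zero) (simp_all add: null_seqs_def)
    have "(\<lambda>n. hamming_dist (m n) (a n \<circ> b n) id) \<longlonglongrightarrow> 0"
    proof (rule tendsto_sandwich[OF _ _ tendsto_const sum])
      show "\<forall>\<^sub>F n in sequentially. 0 \<le> hamming_dist (m n) (a n \<circ> b n) id"
        using hamming_dist_nonneg[OF m permutes_compose[OF perm[OF c(2)] perm[OF c(1)]] id]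
        by (intro always_eventually allI)
    qed (use bound in \<open>intro always_eventually allI\<close>)
    then show "a \<otimes>\<^bsub>seq_group m\<^esub> b \<in> null_seqs m"
      using c by (simp add: null_seqs_def mult)
  qed
  moreover have "a \<otimes>\<^bsub>seq_group m\<^esub> b \<otimes>\<^bsub>seq_group m\<^esub> inv\<^bsub>seq_group m\<^esub> a \<in> null_seqs m"
    if "a \<in> carrier (seq_group m)" "b \<in> null_seqs m" for a b
  proof -
    have b: "b \<in> carrier (seq_group m)"
      using that by (simp add: null_seqs_def)
    have "hamming_dist (m n) (a n \<circ> b n \<circ> Hilbert_Choice.inv (a n)) id = hamming_dist (m n) (b n) id"
      for n
    proof -
      note p = perm[OF that(1), of n] and q = perm[OF b, of n]
      \<comment> \<open>The identity is written as \<open>a n\<close> times its inverse, so that the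
        inverse cancels on the right and then \<open>a n\<close> on the left.\<close>
      have "hamming_dist (m n) (a n \<circ> b n \<circ> Hilbert_Choice.inv (a n)) (a n \<circ> Hilbert_Choice.inv (a n)) =
          hamming_dist (m n) (a n \<circ> b n) (a n \<circ> id)"
        using hamming_dist_right_invariant[OF m permutes_compose[OF q p] p permutes_inv[OF p]] by simp
      also have "\<dots> = hamming_dist (m n) (b n) id"
        by (rule hamming_dist_left_invariant[OF m q id p])
      finally show ?thesis
        using permutes_inv_o(1)[OF p] by simp
    qed
    then show ?thesis
      using that b by (simp add: null_seqs_def mult seq_group_inv)
  qed
  ultimately show ?thesis
    by (simp add: normal_inv_iff)
qed

text \<open>Two right cosets agree exactly when \<open>a\<close> times the inverse of
  \<open>b\<close> is null, and by right invariance the distance of that quotient to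
  \<open>id\<close> is the distance from \<open>a\<close> to \<open>b\<close>.\<close>

lemma null_seqs_coset_eq_iff:
  assumes pos: "\<forall>n. m n > 0" and a: "a \<in> carrier (seq_group m)" and b: "b \<in> carrier (seq_group m)"
  shows "null_seqs m #>\<^bsub>seq_group m\<^esub> a = null_seqs m #>\<^bsub>seq_group m\<^esub> b \<longleftrightarrow>
    (\<lambda>n. hamming_dist (m n) (a n) (b n)) \<longlonglongrightarrow> 0"
proof -
  interpret normal "null_seqs m" "seq_group m"
    by (rule null_seqs_normal[OF pos])
  have m: "m n > 0" for n
    using pos by blast
  have sub: "subgroup (null_seqs m) (seq_group m)"
    by (rule subgroup_axioms)
  have "hamming_dist (m n) ((a \<otimes>\<^bsub>seq_group m\<^esub> inv\<^bsub>seq_group m\<^esub> b) n) id =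
      hamming_dist (m n) (a n) (b n)" for n
  proof -
    have p: "a n permutes {1..m n}" and q: "b n permutes {1..m n}"
      using a b by (simp_all add: seq_group_carrier sym_group_carrier)
    have "hamming_dist (m n) (a n \<circ> Hilbert_Choice.inv (b n)) (b n \<circ> Hilbert_Choice.inv (b n)) =
        hamming_dist (m n) (a n) (b n)"
      by (rule hamming_dist_right_invariant[OF m p q permutes_inv[OF q]])
    then show ?thesis
      using permutes_inv_o(1)[OF q] b by (simp add: seq_group_mult sym_group_mult seq_group_inv)
  qed
  then have "a \<otimes>\<^bsub>seq_group m\<^esub> inv\<^bsub>seq_group m\<^esub> b \<in> null_seqs m \<longleftrightarrow>
      (\<lambda>n. hamming_dist (m n) (a n) (b n)) \<longlonglongrightarrow> 0"
    using m_closed[OF a inv_closed[OF b]] by (simp only: null_seqs_def mem_Collect_eq simp_thms)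
  \<comment> \<open>Equality of cosets is rephrased as membership, the form in which
    \<open>rcos_module\<close> supplies the criterion by quotients.\<close>
  moreover have "null_seqs m #>\<^bsub>seq_group m\<^esub> a = null_seqs m #>\<^bsub>seq_group m\<^esub> b \<longleftrightarrow>
      a \<in> null_seqs m #>\<^bsub>seq_group m\<^esub> b"
    using repr_independence[OF _ b sub, of a] rcos_self[OF a sub] by metis
  ultimately show ?thesis
    using rcos_module[OF group_seq_group b a] by simp
qed

section \<open>The metric reduced product of the symmetric groups along the Frechet filter\<close>

definition seq_quotient :: "(nat \<Rightarrow> nat) \<Rightarrow> (nat \<Rightarrow> nat \<Rightarrow> nat) set monoid" where
  "seq_quotient m = seq_group m Mod null_seqs m"

definition seq_class :: "(nat \<Rightarrow> nat) \<Rightarrow> (nat \<Rightarrow> nat \<Rightarrow> nat) \<Rightarrow> (nat \<Rightarrow> nat \<Rightarrow> nat) set" where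
  "seq_class m a = null_seqs m #>\<^bsub>seq_group m\<^esub> a"

lemma group_seq_quotient: "\<forall>n. m n > 0 \<Longrightarrow> group (seq_quotient m)"
  unfolding seq_quotient_def by (intro normal.factorgroup_is_group null_seqs_normal)

lemma seq_class_hom: "\<forall>n. m n > 0 \<Longrightarrow> seq_class m \<in> hom (seq_group m) (seq_quotient m)"
  unfolding seq_quotient_def seq_class_def[abs_def]
  by (intro normal.r_coset_hom_Mod null_seqs_normal)

lemma seq_class_eq_iff:
  assumes "\<forall>n. m n > 0" "a \<in> carrier (seq_group m)" "b \<in> carrier (seq_group m)"
  shows "seq_class m a = seq_class m b \<longleftrightarrow> (\<lambda>n. hamming_dist (m n) (a n) (b n)) \<longlonglongrightarrow> 0"
  unfolding seq_class_def using assms by (rule null_seqs_coset_eq_iff)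

lemma seq_class_eq_one_iff:
  assumes "\<forall>n. m n > 0" "a \<in> carrier (seq_group m)"
  shows "seq_class m a = \<one>\<^bsub>seq_quotient m\<^esub> \<longleftrightarrow>
    (\<lambda>n. hamming_dist (m n) (a n) \<one>\<^bsub>sym_group (m n)\<^esub>) \<longlonglongrightarrow> 0"
proof -
  have "\<one>\<^bsub>seq_quotient m\<^esub> = seq_class m \<one>\<^bsub>seq_group m\<^esub>"
    using hom_one[OF seq_class_hom group_seq_group group_seq_quotient] assms(1) by simp
  then show ?thesis
    using seq_class_eq_iff[OF assms monoid.one_closed] group_seq_group[of m]
    by (simp add: seq_group_one group.is_monoid)
qed

text \<open>Representatives are chosen separately for each element of \<open>G\<close>, so
  \<open>f\<close> need not respect any group structure. Such raw sequences of maps are what the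
  stability notions start from.\<close>

lemma seq_quotient_maps_lift:
  assumes "u \<in> carrier G \<rightarrow> carrier (seq_quotient m)"
  obtains f where "(\<lambda>g n. f n g) \<in> carrier G \<rightarrow> carrier (seq_group m)"
    "\<And>g. g \<in> carrier G \<Longrightarrow> seq_class m (\<lambda>n. f n g) = u g"
proof -
  have "\<forall>g \<in> carrier G. \<exists>a \<in> carrier (seq_group m). seq_class m a = u g"
    using assms by (fastforce simp: seq_quotient_def seq_class_def carrier_FactGroup)
  then obtain F where "\<And>g. g \<in> carrier G \<Longrightarrow> F g \<in> carrier (seq_group m) \<and> seq_class m (F g) = u g"
    by metis
  then show thesis
    using that[of "\<lambda>n g. F g n"] by auto
qed

section \<open>Asymptotic conditions read as exact conditions in the quotient\<close>

lemma sym_maps_iff: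
  "sym_maps G m f \<longleftrightarrow> (\<forall>n. m n > 0) \<and> (\<lambda>g n. f n g) \<in> carrier G \<rightarrow> carrier (seq_group m)"
  by (auto simp: sym_maps_def seq_group_carrier Pi_iff)

lemma asymp_close_iff:
  assumes "\<forall>n. m n > 0" "(\<lambda>g n. \<rho> n g) \<in> carrier G \<rightarrow> carrier (seq_group m)"
    "(\<lambda>g n. f n g) \<in> carrier G \<rightarrow> carrier (seq_group m)"
  shows "asymp_close G m \<rho> f \<longleftrightarrow>
    (\<forall>g \<in> carrier G. seq_class m (\<lambda>n. \<rho> n g) = seq_class m (\<lambda>n. f n g))"
  using assms seq_class_eq_iff[OF assms(1)] unfolding asymp_close_def Pi_iff by auto

text \<open>For each pair \<open>g\<close>, \<open>h\<close> the limit condition says that the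
  product of the sequences at \<open>g\<close> and \<open>h\<close> and the sequence at their
  product have the same class; as \<open>seq_class\<close> is multiplicative, this is the
  homomorphism equation.\<close>

lemma almost_hom_iff:
  assumes "group G" and m: "\<forall>n. m n > 0"
    and f: "(\<lambda>g n. f n g) \<in> carrier G \<rightarrow> carrier (seq_group m)"
  shows "almost_hom G m f \<longleftrightarrow> (\<lambda>g. seq_class m (\<lambda>n. f n g)) \<in> hom G (seq_quotient m)"
proof -
  interpret G: group G by fact
  interpret P: group "seq_group m" by (rule group_seq_group)
  have "(\<lambda>n. hamming_dist (m n) (f n g \<otimes>\<^bsub>sym_group (m n)\<^esub> f n h) (f n (g \<otimes>\<^bsub>G\<^esub> h))) \<longlonglongrightarrow> 0 \<longleftrightarrow>
      seq_class m (\<lambda>n. f n (g \<otimes>\<^bsub>G\<^esub> h)) =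
      seq_class m (\<lambda>n. f n g) \<otimes>\<^bsub>seq_quotient m\<^esub> seq_class m (\<lambda>n. f n h)"
    if "g \<in> carrier G" "h \<in> carrier G" for g h
  proof -
    have c: "(\<lambda>n. f n g) \<in> carrier (seq_group m)" "(\<lambda>n. f n h) \<in> carrier (seq_group m)"
      "(\<lambda>n. f n (g \<otimes>\<^bsub>G\<^esub> h)) \<in> carrier (seq_group m)"
      using f that G.m_closed[OF that] by (auto simp: Pi_iff)
    have "(\<lambda>n. hamming_dist (m n) (f n g \<otimes>\<^bsub>sym_group (m n)\<^esub> f n h) (f n (g \<otimes>\<^bsub>G\<^esub> h))) \<longlonglongrightarrow> 0 \<longleftrightarrow>
        seq_class m ((\<lambda>n. f n g) \<otimes>\<^bsub>seq_group m\<^esub> (\<lambda>n. f n h)) = seq_class m (\<lambda>n. f n (g \<otimes>\<^bsub>G\<^esub> h))"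
      using seq_class_eq_iff[OF m P.m_closed[OF c(1,2)] c(3)] by (simp add: seq_group_mult)
    then show ?thesis
      using hom_mult[OF seq_class_hom[OF m] c(1,2)] by auto
  qed
  then show ?thesis
    using m f hom_in_carrier[OF seq_class_hom[OF m]]
    by (auto simp: almost_hom_def sym_maps_iff hom_def Pi_iff)
qed

text \<open>\<open>seq_class\<close> commutes with difference operators, so a difference in the
  quotient is the class of the sequence of differences, and it is trivial exactly when that sequence
  is null. The limits concern the identity of \<open>G\<close> only, whence
  \<open>polynomial_map_iff_at_one\<close>.\<close>

lemma almost_polynomial_iff:
  assumes "group G" and m: "\<forall>n. m n > 0"
    and f: "(\<lambda>g n. f n g) \<in> carrier G \<rightarrow> carrier (seq_group m)"
  shows "almost_polynomial s G m f \<longleftrightarrow> unital G (seq_quotient m) (\<lambda>g. seq_class m (\<lambda>n. f n g)) \<and>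
    polynomial_map G (seq_quotient m) s (\<lambda>g. seq_class m (\<lambda>n. f n g))"
proof -
  interpret G: group G by fact
  let ?u = "\<lambda>g. seq_class m (\<lambda>n. f n g)"
  note hom = seq_class_hom[OF m] and U = group_seq_quotient[OF m]
  have u: "?u \<in> carrier G \<rightarrow> carrier (seq_quotient m)"
    using f hom_in_carrier[OF hom] by (auto simp: Pi_iff)
  have "(\<lambda>n. f n \<one>\<^bsub>G\<^esub>) \<in> carrier (seq_group m)"
    using f by (auto simp: Pi_iff)
  then have "asymp_unital G m f \<longleftrightarrow> unital G (seq_quotient m) ?u"
    using seq_class_eq_one_iff[OF m] m f by (simp add: asymp_unital_def sym_maps_iff unital_def)
  moreover have "(\<lambda>n. hamming_dist (m n) (diff_ops G (sym_group (m n)) gs (f n) \<one>\<^bsub>G\<^esub>)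
        \<one>\<^bsub>sym_group (m n)\<^esub>) \<longlonglongrightarrow> 0 \<longleftrightarrow>
      diff_ops G (seq_quotient m) gs ?u \<one>\<^bsub>G\<^esub> = \<one>\<^bsub>seq_quotient m\<^esub>"
    if gs: "gs \<in> lists (carrier G)" for gs
  proof -
    let ?d = "diff_ops G (seq_group m) gs (\<lambda>g n. f n g) \<one>\<^bsub>G\<^esub>"
    have "?d \<in> carrier (seq_group m)"
      using diff_ops_closed[OF assms(1) group_seq_group f gs] by auto
    moreover have "diff_ops G (seq_quotient m) gs ?u \<one>\<^bsub>G\<^esub> = seq_class m ?d"
      by (rule diff_ops_hom[OF assms(1) group_seq_group U hom f gs]) simp_all
    ultimately show ?thesis
      using seq_class_eq_one_iff[OF m] diff_ops_seq_group[OF assms(1) f gs G.one_closed] by simp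
  qed
  ultimately show ?thesis
    unfolding almost_polynomial_def polynomial_map_iff_at_one[OF assms(1) U u] by blast
qed

section \<open>Stability as a lifting property\<close>

text \<open>A homomorphism to the quotient becomes an almost-homomorphism by choosing
  representatives; a correcting sequence of homomorphisms is then a homomorphism to the product with
  the same classes, that is, a lift. The converse reads off the coordinates of a lift.\<close>

lemma P_stable_iff_lifting:
  assumes "group G"
  shows "P_stable G \<longleftrightarrow> (\<forall>m. (\<forall>n. m n > 0) \<longrightarrow> (\<forall>h \<in> hom G (seq_quotient m).
    \<exists>k \<in> hom G (seq_group m). \<forall>g \<in> carrier G. seq_class m (k g) = h g))"
    (is "_ \<longleftrightarrow> ?lift")
proof
  assume stable: "P_stable G"
  show ?lift
  proof (intro allI impI ballI)
    fix m :: "nat \<Rightarrow> nat" and h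
    assume m: "\<forall>n. m n > 0" and h: "h \<in> hom G (seq_quotient m)"
    have hc: "h \<in> carrier G \<rightarrow> carrier (seq_quotient m)"
      using h by (simp add: hom_def)
    then obtain f where f: "(\<lambda>g n. f n g) \<in> carrier G \<rightarrow> carrier (seq_group m)"
      "\<And>g. g \<in> carrier G \<Longrightarrow> seq_class m (\<lambda>n. f n g) = h g"
      using seq_quotient_maps_lift by blast
    \<comment> \<open>The classes of \<open>f\<close> agree with \<open>h\<close> on the carrier
      only, so the homomorphism property is transferred element by element.\<close>
    have "(\<lambda>g. seq_class m (\<lambda>n. f n g)) \<in> hom G (seq_quotient m)"
    proof (rule homI)
      show "seq_class m (\<lambda>n. f n g) \<in> carrier (seq_quotient m)" if "g \<in> carrier G" for g
        using funcset_mem[OF hc that] by (simp only: f(2)[OF that])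
      show "seq_class m (\<lambda>n. f n (g \<otimes>\<^bsub>G\<^esub> g')) =
          seq_class m (\<lambda>n. f n g) \<otimes>\<^bsub>seq_quotient m\<^esub> seq_class m (\<lambda>n. f n g')"
        if "g \<in> carrier G" "g' \<in> carrier G" for g g'
        using hom_mult[OF h that] monoid.m_closed[OF group.is_monoid[OF assms] that] that
        by (simp only: f(2))
    qed
    then have "almost_hom G m f"
      using almost_hom_iff[OF assms m f(1)] by simp
    then obtain \<rho> where \<rho>: "\<forall>n. \<rho> n \<in> hom G (sym_group (m n))" "asymp_close G m \<rho> f"
      using stable unfolding P_stable_def by blast
    then have k: "(\<lambda>g n. \<rho> n g) \<in> hom G (seq_group m)"
      by (simp add: hom_seq_group_iff)
    then have "(\<lambda>g n. \<rho> n g) \<in> carrier G \<rightarrow> carrier (seq_group m)"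
      by (simp add: hom_def)
    then show "\<exists>k \<in> hom G (seq_group m). \<forall>g \<in> carrier G. seq_class m (k g) = h g"
      using k \<rho>(2) f asymp_close_iff[OF m _ f(1)] by (intro bexI[OF _ k]) simp
  qed
next
  assume lift: ?lift
  show "P_stable G"
    unfolding P_stable_def
  proof (intro allI impI)
    fix m f assume almost: "almost_hom G m f"
    then have m: "\<forall>n. m n > 0" and f: "(\<lambda>g n. f n g) \<in> carrier G \<rightarrow> carrier (seq_group m)"
      by (auto simp: almost_hom_def sym_maps_iff)
    have "(\<lambda>g. seq_class m (\<lambda>n. f n g)) \<in> hom G (seq_quotient m)"
      using almost almost_hom_iff[OF assms m f] by simp
    from lift[THEN spec, THEN mp, OF m, THEN bspec, OF this]
    obtain k where k: "k \<in> hom G (seq_group m)"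
      "\<And>g. g \<in> carrier G \<Longrightarrow> seq_class m (k g) = seq_class m (\<lambda>n. f n g)"
      by blast
    have "k \<in> carrier G \<rightarrow> carrier (seq_group m)"
      using k(1) by (simp add: hom_def)
    then have "asymp_close G m (\<lambda>n g. k g n) f"
      using asymp_close_iff[OF m _ f, of "\<lambda>n g. k g n"] k(2) by simp
    then show "\<exists>\<rho>. (\<forall>n. \<rho> n \<in> hom G (sym_group (m n))) \<and> asymp_close G m \<rho> f"
      using k(1) hom_seq_group_iff[of "\<lambda>n g. k g n" G m] by (intro exI[of _ "\<lambda>n g. k g n"]) simp
  qed
qed

lemma poly_P_stable_iff_lifting:
  assumes "group G"
  shows "poly_P_stable s G \<longleftrightarrow> (\<forall>m. (\<forall>n. m n > 0) \<longrightarrow>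
    (\<forall>u. unital G (seq_quotient m) u \<and> polynomial_map G (seq_quotient m) s u \<longrightarrow>
      (\<exists>r. unital G (seq_group m) r \<and> polynomial_map G (seq_group m) s r \<and>
        (\<forall>g \<in> carrier G. seq_class m (r g) = u g))))"
    (is "_ \<longleftrightarrow> ?lift")
proof
  assume stable: "poly_P_stable s G"
  show ?lift
  proof (intro allI impI)
    fix m :: "nat \<Rightarrow> nat" and u
    assume m: "\<forall>n. m n > 0"
      and u: "unital G (seq_quotient m) u \<and> polynomial_map G (seq_quotient m) s u"
    have uc: "u \<in> carrier G \<rightarrow> carrier (seq_quotient m)"
      using u by (simp add: polynomial_map_def)
    then obtain f where f: "(\<lambda>g n. f n g) \<in> carrier G \<rightarrow> carrier (seq_group m)"
      "\<And>g. g \<in> carrier G \<Longrightarrow> seq_class m (\<lambda>n. f n g) = u g"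
      using seq_quotient_maps_lift by blast
    let ?u = "\<lambda>g. seq_class m (\<lambda>n. f n g)"
    have "?u \<in> carrier G \<rightarrow> carrier (seq_quotient m)"
      using uc f(2) by auto
    \<comment> \<open>Again \<open>?u\<close> and \<open>u\<close> agree on the carrier only;
      naturality along the identity homomorphism identifies their differences there.\<close>
    moreover have "diff_ops G (seq_quotient m) gs ?u x = diff_ops G (seq_quotient m) gs u x"
      if "gs \<in> lists (carrier G)" "x \<in> carrier G" for gs x
      using group_seq_quotient[OF m] f(2) uc that
      by (intro diff_ops_hom[where h = "\<lambda>y. y"] assms) (auto simp: hom_def)
    ultimately have "unital G (seq_quotient m) ?u \<and> polynomial_map G (seq_quotient m) s ?u"
      using u f(2) assms by (simp add: unital_def polynomial_map_def group.is_monoid monoid.one_closed)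
    then have "almost_polynomial s G m f"
      using almost_polynomial_iff[OF assms m f(1)] by simp
    then obtain \<rho> where \<rho>: "\<forall>n. unital G (sym_group (m n)) (\<rho> n) \<and>
        polynomial_map G (sym_group (m n)) s (\<rho> n)" "asymp_close G m \<rho> f"
      using stable unfolding poly_P_stable_def by blast
    then have r: "unital G (seq_group m) (\<lambda>g n. \<rho> n g)" "polynomial_map G (seq_group m) s (\<lambda>g n. \<rho> n g)"
      using unital_polynomial_seq_group_iff[OF assms] by blast+
    then have "(\<lambda>g n. \<rho> n g) \<in> carrier G \<rightarrow> carrier (seq_group m)"
      by (simp add: polynomial_map_def)
    then show "\<exists>r. unital G (seq_group m) r \<and> polynomial_map G (seq_group m) s r \<and>
        (\<forall>g \<in> carrier G. seq_class m (r g) = u g)"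
      using r \<rho>(2) f asymp_close_iff[OF m _ f(1)] by (intro exI[of _ "\<lambda>g n. \<rho> n g"]) simp
  qed
next
  assume lift: ?lift
  show "poly_P_stable s G"
    unfolding poly_P_stable_def
  proof (intro allI impI)
    fix m f assume almost: "almost_polynomial s G m f"
    then have m: "\<forall>n. m n > 0" and f: "(\<lambda>g n. f n g) \<in> carrier G \<rightarrow> carrier (seq_group m)"
      by (auto simp: almost_polynomial_def asymp_unital_def sym_maps_iff)
    have "unital G (seq_quotient m) (\<lambda>g. seq_class m (\<lambda>n. f n g)) \<and>
        polynomial_map G (seq_quotient m) s (\<lambda>g. seq_class m (\<lambda>n. f n g))"
      using almost almost_polynomial_iff[OF assms m f] by simp
    from lift[THEN spec, THEN mp, OF m, THEN spec, THEN mp, OF this]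
    obtain r where r: "unital G (seq_group m) r" "polynomial_map G (seq_group m) s r"
      "\<And>g. g \<in> carrier G \<Longrightarrow> seq_class m (r g) = seq_class m (\<lambda>n. f n g)"
      by blast
    have "r \<in> carrier G \<rightarrow> carrier (seq_group m)"
      using r(2) by (simp add: polynomial_map_def)
    then have "asymp_close G m (\<lambda>n g. r g n) f"
      using asymp_close_iff[OF m _ f, of "\<lambda>n g. r g n"] r(3) by simp
    then show "\<exists>\<rho>. (\<forall>n. unital G (sym_group (m n)) (\<rho> n) \<and> polynomial_map G (sym_group (m n)) s (\<rho> n)) \<and>
        asymp_close G m \<rho> f"
      using r(1,2) unital_polynomial_seq_group_iff[OF assms, of m "\<lambda>n g. r g n" s]
      by (intro exI[of _ "\<lambda>n g. r g n"]) simp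
  qed
qed

text \<open>The two lifting properties are matched for each positive degree sequence
  \<open>m\<close> separately, by \<open>Pol_lifting_iff\<close> with \<open>seq_class m\<close> as
  the map \<open>q\<close>.\<close>

theorem theorem1p1:
  fixes G :: "('a, 'c) monoid_scheme" and s :: nat
  assumes "group G" and "s \<ge> 1"
  shows "poly_P_stable s G \<longleftrightarrow> P_stable (Pol s G)"
  unfolding poly_P_stable_iff_lifting[OF assms(1)] P_stable_iff_lifting[OF group_Pol[OF assms(1)]]
  using Pol_lifting_iff[OF assms(1) group_seq_group group_seq_quotient seq_class_hom]
  by simp

end
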